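(* Let $(A,\circ,[\cdot,\cdot])$ be a GD algebra over $\Bbbk$ with $\dim A\le 3$. If the underlying Lie algebra $(A,[\cdot,\cdot])$ and the underlying Novikov algebra $(A,\circ)$ are both solvable, then $A$ is solvable (as a GD algebra).
   Context: $\Bbbk$ is an algebraically closed field of characteristic $0$. A Novikov algebra is a vector space with a bilinear product $\circ$ satisfying $(x\circ y)\circ z-x\circ(y\circ z)=(y\circ x)\circ z-y\circ(x\circ z)$ and $(x\circ y)\circ z=(x\circ z)\circ y$. A Gelfand--Dorfman (GD) algebra is a triple $(A,\circ,[\cdot,\cdot])$ such that $(A,\circ)$ is a Novikov algebra, $(A,[\cdot,\cdot])$ is a Lie algebra, and for all $x,y,z\in A$: $[x,y\circ z]-[z,y\circ x]+[y,x]\circ z-[y,z]\circ x-y\circ[x,z]=0$. The GD derived series is $A^{(0)}=A$, $A^{(n+1)}=A^{(n)}\circ A^{(n)}+[A^{(n)},A^{(n)}]$ (linear spans); $A$ is solvable if $A^{(N)}=0$ for some $N\ge0$. The Novikov algebra $(A,\circ)$ is solvable if the analogous series $A\mapsto A\circ A$ using only $\circ$ reaches $0$. *)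

theory Defs
  imports "HOL-Computational_Algebra.Polynomial"
begin

(* Algebras are carried by a whole type 'a; "scale" is the action of the ground field on it. *)
locale nonassoc_algebra = vector_space scale
  for scale :: "'k::field \<Rightarrow> 'a::ab_group_add \<Rightarrow> 'a" +
  fixes mul :: "'a \<Rightarrow> 'a \<Rightarrow> 'a"
  assumes linear_left: "\<And>y. Vector_Spaces.linear scale scale (\<lambda>x. mul x y)"
    and linear_right: "\<And>x. Vector_Spaces.linear scale scale (\<lambda>y. mul x y)"
begin

definition prod_span :: "'a set \<Rightarrow> 'a set \<Rightarrow> 'a set" where
  "prod_span U V = span {mul x y | x y. x \<in> U \<and> y \<in> V}"

primrec derived_series :: "nat \<Rightarrow> 'a set" where
  "derived_series 0 = UNIV"
| "derived_series (Suc n) = prod_span (derived_series n) (derived_series n)"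

definition solvable :: bool where
  "solvable \<longleftrightarrow> (\<exists>N. derived_series N = {0})"

end

locale novikov_algebra = nonassoc_algebra scale circ
  for scale :: "'k::field \<Rightarrow> 'a::ab_group_add \<Rightarrow> 'a"
    and circ :: "'a \<Rightarrow> 'a \<Rightarrow> 'a" (infixl \<open>\<circ>\<^sub>N\<close> 70) +
  assumes left_symmetric:
      "(x \<circ>\<^sub>N y) \<circ>\<^sub>N z - x \<circ>\<^sub>N (y \<circ>\<^sub>N z) = (y \<circ>\<^sub>N x) \<circ>\<^sub>N z - y \<circ>\<^sub>N (x \<circ>\<^sub>N z)"
    and right_commutative: "(x \<circ>\<^sub>N y) \<circ>\<^sub>N z = (x \<circ>\<^sub>N z) \<circ>\<^sub>N y"

locale lie_algebra = nonassoc_algebra scale bracket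
  for scale :: "'k::field \<Rightarrow> 'a::ab_group_add \<Rightarrow> 'a"
    and bracket :: "'a \<Rightarrow> 'a \<Rightarrow> 'a" +
  assumes alternating: "bracket x x = 0"
    and jacobi: "bracket x (bracket y z) + bracket y (bracket z x) + bracket z (bracket x y) = 0"

locale gd_algebra =
  vector_space scale + nov: novikov_algebra scale circ + lie: lie_algebra scale bracket
  for scale :: "'k::field \<Rightarrow> 'a::ab_group_add \<Rightarrow> 'a"
    and circ :: "'a \<Rightarrow> 'a \<Rightarrow> 'a" (infixl \<open>\<circ>\<^sub>N\<close> 70)
    and bracket :: "'a \<Rightarrow> 'a \<Rightarrow> 'a" +
  assumes compatible:
    "bracket x (y \<circ>\<^sub>N z) - bracket z (y \<circ>\<^sub>N x) + bracket y x \<circ>\<^sub>N z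
      - bracket y z \<circ>\<^sub>N x - y \<circ>\<^sub>N bracket x z = 0"
begin

primrec gd_derived_series :: "nat \<Rightarrow> 'a set" where
  "gd_derived_series 0 = UNIV"
| "gd_derived_series (Suc n) =
    {u + v | u v. u \<in> nov.prod_span (gd_derived_series n) (gd_derived_series n)
                \<and> v \<in> lie.prod_span (gd_derived_series n) (gd_derived_series n)}"

definition gd_solvable :: bool where
  "gd_solvable \<longleftrightarrow> (\<exists>N. gd_derived_series N = {0})"

end

end

theory Submission
  imports Defs
begin

text \<open>
  The derived series of a GD algebra consists of GD subalgebras, and solvability of the two
  underlying algebras restricts to them.  So it is enough that a nonzero subalgebra \<open>S\<close> of dimension
  at most three is never \<^emph>\<open>perfect\<close>, that is, never equal to \<open>S \<circ> S + [S, S]\<close>; each step of the series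
  then drops the dimension.

  Let \<open>S\<close> be perfect and \<open>h = [S, S]\<close>.  Lie solvability makes \<open>h\<close> a proper subspace, so
  \<open>dim h \<le> 2\<close>.  Contradictions mostly come from one device, \<open>character_vanishes\<close>: a linear functional
  \<open>E\<close> that kills \<open>h\<close> and satisfies \<open>E (x \<circ> y) = c E x E y\<close> on \<open>S\<close> is zero on \<open>S\<close>.  For \<open>c = 0\<close> this is
  perfectness, and for \<open>c \<noteq> 0\<close> the elements \<open>x\<close>, \<open>x \<circ> x\<close>, \<open>(x \<circ> x) \<circ> (x \<circ> x)\<close>, \<dots> would witness that the
  Novikov product is not solvable.

  If \<open>h\<close> is spanned by one vector \<open>z\<close>, then \<open>z\<close> is not in \<open>S \<circ> S\<close>, for otherwise \<open>S = S \<circ> S\<close>.  Write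
  \<open>[x, y] = \<omega>(x, y) z\<close>.  As \<open>z\<close> is independent of \<open>S \<circ> S\<close>, the compatibility identity splits into the
  two identities \<open>\<omega>_circ_symmetric\<close> and \<open>circ_line_cocycle\<close>.  When \<open>z\<close> is not central they turn
  \<open>\<omega>(_, z)\<close> into such a functional (\<open>noncentral_impossible\<close>).  When \<open>z\<close> is central they force \<open>z\<close> to
  annihilate \<open>S\<close> under the Novikov product from both sides; then \<open>S \<circ> S = (S \<circ> S) \<circ> (S \<circ> S)\<close>, which
  Novikov solvability forbids (\<open>central_impossible\<close>).

  If \<open>dim h = 2\<close>, then \<open>h\<close> is abelian and \<open>S = h + k e\<close> (\<open>derived_plane_abelian\<close>).  The coordinate \<open>E\<close>
  along \<open>e\<close> is shown to be such a functional, after the compatibility identity gives \<open>E (h \<circ> h) = 0\<close> and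
  makes \<open>x \<mapsto> - E (x \<circ> e)\<close> a character of \<open>(h, \<circ>)\<close>, hence zero (\<open>plane_case\<close>).
\<close>

section \<open>Solvable algebras\<close>

context nonassoc_algebra
begin

lemma mul_add_left: "mul (x + y) z = mul x z + mul y z"
  and mul_scale_left: "mul (scale c x) z = scale c (mul x z)"
  and mul_diff_left: "mul (x - y) z = mul x z - mul y z"
  and mul_zero_left: "mul 0 z = 0"
proof -
  interpret l: Vector_Spaces.linear scale scale "\<lambda>x. mul x z" by (rule linear_left)
  show "mul (x + y) z = mul x z + mul y z" by (rule l.add)
  show "mul (scale c x) z = scale c (mul x z)" by (rule l.scale)
  show "mul (x - y) z = mul x z - mul y z" by (rule l.diff)
  show "mul 0 z = 0" by (rule l.zero)
qed

lemma mul_add_right: "mul z (x + y) = mul z x + mul z y"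
  and mul_scale_right: "mul z (scale c x) = scale c (mul z x)"
  and mul_diff_right: "mul z (x - y) = mul z x - mul z y"
  and mul_zero_right: "mul z 0 = 0"
proof -
  interpret l: Vector_Spaces.linear scale scale "\<lambda>x. mul z x" by (rule linear_right)
  show "mul z (x + y) = mul z x + mul z y" by (rule l.add)
  show "mul z (scale c x) = scale c (mul z x)" by (rule l.scale)
  show "mul z (x - y) = mul z x - mul z y" by (rule l.diff)
  show "mul z 0 = 0" by (rule l.zero)
qed

lemma mul_in_prod_span: "x \<in> U \<Longrightarrow> y \<in> V \<Longrightarrow> mul x y \<in> prod_span U V"
  unfolding prod_span_def by (rule span_base) blast

lemma subspace_prod_span: "subspace (prod_span U V)"
  unfolding prod_span_def by (rule subspace_span)

lemma prod_span_least:
  assumes "subspace W" "\<And>x y. x \<in> U \<Longrightarrow> y \<in> V \<Longrightarrow> mul x y \<in> W"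
  shows "prod_span U V \<subseteq> W"
  unfolding prod_span_def using assms by (intro span_minimal) auto

lemma prod_span_mono: "U \<subseteq> U' \<Longrightarrow> V \<subseteq> V' \<Longrightarrow> prod_span U V \<subseteq> prod_span U' V'"
  unfolding prod_span_def by (intro span_mono) blast

lemma mul_span_in:
  assumes W: "subspace W" and B: "\<And>x y. x \<in> U \<Longrightarrow> y \<in> V \<Longrightarrow> mul x y \<in> W"
    and x: "x \<in> span U" and y: "y \<in> span V"
  shows "mul x y \<in> W"
proof -
  have right: "mul x' y \<in> W" if "x' \<in> U" for x'
    using y
  proof (induction rule: span_induct_alt)
    case base show ?case by (simp add: mul_zero_right subspace_0[OF W])
  next
    case (step c v w) then show ?case
      by (simp add: mul_add_right mul_scale_right subspace_add[OF W] subspace_scale[OF W] B that)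
  qed
  show ?thesis
    using x
  proof (induction rule: span_induct_alt)
    case base show ?case by (simp add: mul_zero_left subspace_0[OF W])
  next
    case (step c v w) then show ?case
      by (simp add: mul_add_left mul_scale_left subspace_add[OF W] subspace_scale[OF W] right)
  qed
qed

lemma solvable_perfect_trivial:
  assumes "solvable" and perfect: "T \<subseteq> prod_span T T"
  shows "T \<subseteq> {0}"
proof -
  have "T \<subseteq> derived_series n" for n
  proof (induction n)
    case (Suc n)
    then show ?case using perfect prod_span_mono[OF Suc Suc] by auto
  qed simp
  with \<open>solvable\<close> show ?thesis unfolding solvable_def by metis
qed

text \<open>
  Iterated squares \<open>x\<close>, \<open>x x\<close>, \<open>(x x)(x x)\<close>, \<dots> run through the derived series, and a multiplicative
  functional that is nonzero at \<open>x\<close> stays nonzero along them.  Allowing a factor \<open>c\<close> saves normalising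
  the functional.
\<close>

lemma solvable_no_character:
  fixes \<phi> :: "'a \<Rightarrow> 'k"
  assumes "solvable" and zero: "\<phi> 0 = 0"
    and closed: "\<And>x y. x \<in> T \<Longrightarrow> y \<in> T \<Longrightarrow> mul x y \<in> T"
    and mult: "\<And>x y. x \<in> T \<Longrightarrow> y \<in> T \<Longrightarrow> \<phi> (mul x y) = c * \<phi> x * \<phi> y"
    and "c \<noteq> 0" "x \<in> T"
  shows "\<phi> x = 0"
proof (rule ccontr)
  assume nz: "\<phi> x \<noteq> 0"
  have "\<exists>y \<in> derived_series n. y \<in> T \<and> \<phi> y \<noteq> 0" for n
  proof (induction n)
    case 0 show ?case using nz \<open>x \<in> T\<close> by auto
  next
    case (Suc n)
    then obtain y where y: "y \<in> derived_series n" "y \<in> T" "\<phi> y \<noteq> 0" by blast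
    then have "mul y y \<in> derived_series (Suc n)" "mul y y \<in> T" "\<phi> (mul y y) \<noteq> 0"
      using \<open>c \<noteq> 0\<close> by (auto simp: mul_in_prod_span closed mult)
    then show ?case by blast
  qed
  then show False using \<open>solvable\<close> zero unfolding solvable_def by (metis singletonD)
qed

end

section \<open>Linear algebra in small dimension\<close>

context vector_space
begin

lemma span_insert_span: "span (insert e (span Y)) = span (insert e Y)"
  by (simp add: span_insert span_span)

lemma span_pairE:
  assumes "x \<in> span {c, d}"
  obtains \<alpha> \<beta> where "x = scale \<alpha> c + scale \<beta> d"
proof -
  obtain \<alpha> where "x - scale \<alpha> c \<in> span {d}" using assms span_breakdown_eq by blast
  then obtain \<beta> where "x - scale \<alpha> c = scale \<beta> d" by (auto simp: span_singleton)
  then show thesis by (intro that[of \<alpha> \<beta>]) (simp add: algebra_simps)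
qed

lemma separating_functional:
  assumes W: "subspace W" and v: "v \<notin> W"
  obtains f :: "'b \<Rightarrow> 'a" where "Vector_Spaces.linear scale (*) f"
    "\<And>w. w \<in> W \<Longrightarrow> f w = 0" "f v = 1"
proof -
  have "vector_space ((*) :: 'a \<Rightarrow> 'a \<Rightarrow> 'a)"
    by (intro vector_space.intro)
      (simp_all only: distrib_left distrib_right mult.assoc mult_1_left)
  then have pair: "vector_space_pair scale ((*) :: 'a \<Rightarrow> 'a \<Rightarrow> 'a)"
    by (rule vector_space_pair.intro[OF vector_space_axioms])
  obtain B where B: "B \<subseteq> W" "independent B" "W \<subseteq> span B"
    by (rule basis_exists)
  have "span B = W" using B(1,3) W by (rule span_subspace)
  then have "independent (insert v B)"
    using B(2) v by (intro independent_insertI) simp_all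
  from vector_space_pair.linear_independent_extend[OF pair this, of "\<lambda>x. if x = v then 1 else 0"]
  obtain f where f: "Vector_Spaces.linear scale (*) f"
    "\<forall>x \<in> insert v B. f x = (if x = v then 1 else 0)" by blast
  have zero: "f b = 0" if "b \<in> B" for b
    using f(2) that B(1) v by auto
  have "f w = 0" if "w \<in> W" for w
    using vector_space_pair.linear_eq_0_on_span[OF pair f(1) zero] that B(3) by blast
  moreover have "f v = 1" using f(2) by simp
  ultimately show thesis using that f(1) by blast
qed

end

context finite_dimensional_vector_space
begin

lemma plane_spanned_through:
  assumes h: "subspace h" "dim h = 2" and c: "c \<in> h" "c \<noteq> 0"
  obtains d where "d \<in> h" "d \<notin> span {c}" "h = span {c, d}"
proof -
  have dimc: "dim (span {c}) = 1" using c by (simp add: dim_insert)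
  then have "h \<noteq> span {c}" using h by auto
  moreover have "span {c} \<subseteq> h" using c h by (simp add: span_minimal)
  ultimately obtain d where d: "d \<in> h" "d \<notin> span {c}" by blast
  have "dim (span {c, d}) = 2"
    using d dimc by (simp add: insert_commute[of c d] dim_insert[of d "{c}"])
  moreover have "span {c, d} \<subseteq> h" using c d h by (simp add: span_minimal)
  ultimately have "span {c, d} = h" using h by (intro subspace_dim_equal) auto
  with d that show thesis by blast
qed

end

section \<open>Perfect subalgebras of dimension at most three\<close>

text \<open>
  The hypothetical situation to be refuted for \<open>S \<noteq> {0}\<close>.  It is phrased for a subset of a larger
  algebra because it will be applied to the members of the derived series.
\<close>

locale perfect_gd_subalgebra =
  gd_algebra scale circ bracket + finite_dimensional_vector_space scale Basis
  for scale :: "'k::field_char_0 \<Rightarrow> 'a::ab_group_add \<Rightarrow> 'a"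
    and circ :: "'a \<Rightarrow> 'a \<Rightarrow> 'a" (infixl \<open>\<circ>\<^sub>N\<close> 70)
    and bracket :: "'a \<Rightarrow> 'a \<Rightarrow> 'a"
    and Basis :: "'a set" +
  fixes S :: "'a set"
  assumes subspace_S: "subspace S"
    and dim_S: "dim S \<le> 3"
    and circ_closed: "\<And>x y. x \<in> S \<Longrightarrow> y \<in> S \<Longrightarrow> x \<circ>\<^sub>N y \<in> S"
    and bracket_closed: "\<And>x y. x \<in> S \<Longrightarrow> y \<in> S \<Longrightarrow> bracket x y \<in> S"
    and circ_solvable: "nov.solvable"
    and bracket_solvable: "lie.solvable"
    and perfect: "S \<subseteq> {u + v | u v. u \<in> nov.prod_span S S \<and> v \<in> lie.prod_span S S}"
begin

lemmas S_intros = circ_closed bracket_closed subspace_add[OF subspace_S]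
  subspace_diff[OF subspace_S] subspace_scale[OF subspace_S] subspace_0[OF subspace_S]

lemma bracket_skew: "bracket y x = - bracket x y"
proof -
  have "bracket x y + bracket y x
      = bracket (x + y) (x + y) - bracket x x - bracket y y"
    by (simp add: lie.mul_add_left lie.mul_add_right)
  then have "bracket x y + bracket y x = 0" by (simp add: lie.alternating)
  then show ?thesis by (simp add: eq_neg_iff_add_eq_0 add.commute)
qed

lemma subspace_containing_products:
  assumes W: "subspace W"
    and "\<And>x y. x \<in> S \<Longrightarrow> y \<in> S \<Longrightarrow> x \<circ>\<^sub>N y \<in> W" "\<And>x y. x \<in> S \<Longrightarrow> y \<in> S \<Longrightarrow> bracket x y \<in> W"
  shows "S \<subseteq> W"
proof -
  have "nov.prod_span S S \<subseteq> W" "lie.prod_span S S \<subseteq> W"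
    by (rule nov.prod_span_least lie.prod_span_least; fact)+
  with perfect subspace_add[OF W] show ?thesis by blast
qed

lemma functional_vanishes:
  fixes F :: "'a \<Rightarrow> 'k"
  assumes F: "Vector_Spaces.linear scale (*) F"
    and "\<And>x y. x \<in> S \<Longrightarrow> y \<in> S \<Longrightarrow> F (x \<circ>\<^sub>N y) = 0"
    and "\<And>x y. x \<in> S \<Longrightarrow> y \<in> S \<Longrightarrow> F (bracket x y) = 0"
    and "x \<in> S"
  shows "F x = 0"
proof -
  interpret F: Vector_Spaces.linear scale "(*)" F by (rule F)
  have "S \<subseteq> {x. F x = 0}"
    using assms by (intro subspace_containing_products)
      (auto simp: subspace_def F.add F.scale F.zero)
  with assms show ?thesis by blast
qed

text \<open>
  The two ways of contradicting the assumptions, merged: \<open>c = 0\<close> conflicts with perfectness and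
  \<open>c \<noteq> 0\<close> with Novikov solvability.
\<close>

lemma character_vanishes:
  fixes F :: "'a \<Rightarrow> 'k"
  assumes F: "Vector_Spaces.linear scale (*) F"
    and mult: "\<And>x y. x \<in> S \<Longrightarrow> y \<in> S \<Longrightarrow> F (x \<circ>\<^sub>N y) = c * F x * F y"
    and brac: "\<And>x y. x \<in> S \<Longrightarrow> y \<in> S \<Longrightarrow> F (bracket x y) = 0"
    and x: "x \<in> S"
  shows "F x = 0"
proof (cases "c = 0")
  case True
  show ?thesis by (rule functional_vanishes[OF F _ brac x]) (simp_all add: mult True)
next
  case False
  interpret F: Vector_Spaces.linear scale "(*)" F by (rule F)
  show ?thesis
    by (rule nov.solvable_no_character[OF circ_solvable F.zero circ_closed mult False x])
qed

end

section \<open>Bracket with one-dimensional range\<close>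

text \<open>
  Here the bracket has rank one with range \<open>k z\<close>, and \<open>z\<close> lies outside \<open>S \<circ> S\<close>; the functional \<open>f\<close>
  witnesses the latter and at the same time reads off the coefficient of \<open>z\<close> in a bracket.
\<close>

locale perfect_gd_line = perfect_gd_subalgebra scale circ bracket Basis S
  for scale :: "'k::field_char_0 \<Rightarrow> 'a::ab_group_add \<Rightarrow> 'a"
    and circ :: "'a \<Rightarrow> 'a \<Rightarrow> 'a" (infixl \<open>\<circ>\<^sub>N\<close> 70)
    and bracket :: "'a \<Rightarrow> 'a \<Rightarrow> 'a"
    and Basis S :: "'a set" +
  fixes z :: 'a and f :: "'a \<Rightarrow> 'k"
  assumes z: "z \<in> S" "z \<noteq> 0"
    and bracket_range: "lie.prod_span S S = span {z}"
    and f_linear: "Vector_Spaces.linear scale (*) f"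
    and f_circ: "\<And>x. x \<in> nov.prod_span S S \<Longrightarrow> f x = 0"
    and f_z: "f z = 1"
begin

sublocale f: Vector_Spaces.linear scale "(*)" f by (rule f_linear)

definition \<omega> :: "'a \<Rightarrow> 'a \<Rightarrow> 'k" where "\<omega> x y = f (bracket x y)"

lemma f_prod: "x \<in> S \<Longrightarrow> y \<in> S \<Longrightarrow> f (x \<circ>\<^sub>N y) = 0"
  by (intro f_circ nov.mul_in_prod_span)

lemma bracket_eq:
  assumes "x \<in> S" "y \<in> S" shows "bracket x y = scale (\<omega> x y) z"
proof -
  have "bracket x y \<in> span {z}" using assms bracket_range lie.mul_in_prod_span by auto
  then obtain k where "bracket x y = scale k z" by (auto simp: span_singleton)
  then show ?thesis by (simp add: \<omega>_def f.scale f_z)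
qed

lemma \<omega>_linear_left: "Vector_Spaces.linear scale (*) (\<lambda>x. \<omega> x y)"
  unfolding \<omega>_def using Vector_Spaces.linear_compose[OF lie.linear_left f_linear] by (simp add: o_def)

lemma \<omega>_skew: "\<omega> y x = - \<omega> x y"
  unfolding \<omega>_def by (subst bracket_skew) (simp add: f.neg)

lemma \<omega>_self [simp]: "\<omega> x x = 0"
  by (simp add: \<omega>_def lie.alternating f.zero)

lemma \<omega>_scale_right: "\<omega> x (scale k y) = k * \<omega> x y"
  by (simp add: \<omega>_def lie.mul_scale_right f.scale)

lemma compatible_on_line:
  assumes "a \<in> S" "b \<in> S" "y \<in> S"
  shows "scale (\<omega> a (y \<circ>\<^sub>N b)) z - scale (\<omega> b (y \<circ>\<^sub>N a)) z
    + scale (\<omega> y a) (z \<circ>\<^sub>N b) - scale (\<omega> y b) (z \<circ>\<^sub>N a) - scale (\<omega> a b) (y \<circ>\<^sub>N z) = 0"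
  using compatible[of a y b] assms
  by (simp add: bracket_eq S_intros nov.mul_scale_left nov.mul_scale_right)

text \<open>
  In the compatibility identity on \<open>S\<close> the first two terms are multiples of \<open>z\<close> and the others lie in
  \<open>S \<circ> S\<close>.  The functional \<open>f\<close> sees only the former, so both groups vanish separately.
\<close>

lemma \<omega>_circ_symmetric:
  assumes "a \<in> S" "b \<in> S" "y \<in> S"
  shows "\<omega> a (y \<circ>\<^sub>N b) = \<omega> b (y \<circ>\<^sub>N a)"
  using arg_cong[OF compatible_on_line[OF assms], of f] assms z
  by (simp add: f.add f.diff f.scale f_z f_prod f.zero)

lemma circ_line_cocycle:
  assumes "a \<in> S" "b \<in> S" "y \<in> S"
  shows "scale (\<omega> y a) (z \<circ>\<^sub>N b) = scale (\<omega> y b) (z \<circ>\<^sub>N a) + scale (\<omega> a b) (y \<circ>\<^sub>N z)"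
  using compatible_on_line[OF assms] \<omega>_circ_symmetric[OF assms] by (simp add: algebra_simps)

text \<open>
  The functional \<open>E = \<omega>(_, z)\<close> kills the bracket.  Normalise \<open>\<omega>(e, z) = 1\<close>.  The cocycle identity gives
  \<open>y \<circ> z = - z \<circ> y\<close> and \<open>z \<circ> a = E(a) z \<circ> e\<close>; together with the symmetry identity this yields
  \<open>E (x \<circ> y) = \<omega>(e, z \<circ> e) E x E y\<close>, although \<open>E e = 1\<close>.
\<close>

lemma noncentral_impossible:
  assumes e0: "e0 \<in> S" "bracket e0 z \<noteq> 0"
  shows False
proof -
  define e where "e = scale (1 / \<omega> e0 z) e0"
  have "\<omega> e0 z \<noteq> 0" using e0 z bracket_eq[of e0 z] by auto
  then have e: "e \<in> S" "\<omega> e z = 1"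
    using e0 S_intros by (auto simp: e_def \<omega>_def lie.mul_scale_left f.scale)
  define u where "u = z \<circ>\<^sub>N e"
  have anti: "y \<circ>\<^sub>N z = - (z \<circ>\<^sub>N y)" if y: "y \<in> S" for y
  proof (cases "\<forall>b\<in>S. \<omega> y b = 0")
    \<comment> \<open>For \<open>y\<close> in the radical of \<open>\<omega>\<close> both products vanish: test against a pair on which \<open>\<omega>\<close> does not.\<close>
    case True
    have "y \<circ>\<^sub>N z = 0" using circ_line_cocycle[of e z y] True y z e by simp
    moreover have "z \<circ>\<^sub>N y = 0"
      using circ_line_cocycle[of y z e] True y z e \<omega>_skew[of e y] by simp
    ultimately show ?thesis by simp
  next
    case False
    then obtain b where b: "b \<in> S" "\<omega> y b \<noteq> 0" by blast
    have "scale (\<omega> y b) (z \<circ>\<^sub>N y + y \<circ>\<^sub>N z) = 0"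
      using circ_line_cocycle[of y b y] y b by (simp add: scale_right_distrib)
    with b show ?thesis by (simp add: eq_neg_iff_add_eq_0 add.commute)
  qed
  \<comment> \<open>Characteristic different from two enters here.\<close>
  have zz: "z \<circ>\<^sub>N z = 0"
  proof -
    have "scale 2 (z \<circ>\<^sub>N z) = z \<circ>\<^sub>N z + z \<circ>\<^sub>N z"
      using scale_left_distrib[of 1 1 "z \<circ>\<^sub>N z"] by simp
    also have "\<dots> = 0" using anti[OF z(1)] by (simp only: eq_neg_iff_add_eq_0)
    finally show ?thesis by simp
  qed
  have z_circ: "z \<circ>\<^sub>N a = scale (\<omega> a z) u" if a: "a \<in> S" for a
    using circ_line_cocycle[of a e z] a e z zz \<omega>_skew[of z a] \<omega>_skew[of z e] by (simp add: u_def)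
  have \<omega>_u: "\<omega> b u = \<omega> b z * \<omega> e u" if b: "b \<in> S" for b
    using \<omega>_circ_symmetric[of b e z] b e z z_circ[OF b] by (simp add: u_def \<omega>_scale_right)
  have "\<omega> (x \<circ>\<^sub>N y) z = \<omega> e u * \<omega> x z * \<omega> y z" if x: "x \<in> S" and y: "y \<in> S" for x y
  proof -
    have "\<omega> (x \<circ>\<^sub>N y) z = - \<omega> z (x \<circ>\<^sub>N y)" by (rule \<omega>_skew)
    also have "\<dots> = - \<omega> y (x \<circ>\<^sub>N z)" using \<omega>_circ_symmetric[of z y x] x y z by simp
    also have "\<dots> = \<omega> x z * \<omega> y u"
      using \<omega>_scale_right[of y "-1"] \<omega>_scale_right[of y _ u]
      by (simp add: anti[OF x] z_circ[OF x])
    finally show ?thesis using \<omega>_u[OF y] by simp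
  qed
  moreover have "\<omega> (bracket x y) z = 0" if "x \<in> S" "y \<in> S" for x y
    unfolding bracket_eq[OF that]
    by (simp add: \<omega>_def lie.mul_scale_left lie.alternating f.scale f.zero)
  ultimately have "\<omega> e z = 0"
    using character_vanishes[of "\<lambda>x. \<omega> x z" "\<omega> e u" e, OF \<omega>_linear_left[of z]] e(1) by blast
  with e show False by simp
qed

text \<open>
  If \<open>\<omega>(a, b) \<noteq> 0\<close> then \<open>a, b, z\<close> are independent, hence a basis of \<open>S\<close>: the subalgebra is a Heisenberg
  algebra and the radical of \<open>\<omega>\<close> is exactly \<open>k z\<close>.  By the symmetry identity \<open>y \<circ> z\<close> lies in that radical
  and therefore vanishes, as \<open>z\<close> is not in \<open>S \<circ> S\<close>; then \<open>z \<circ> y = 0\<close> by the cocycle identity.  So the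
  summand \<open>k z\<close> of \<open>S = S \<circ> S + k z\<close> contributes nothing to products, and \<open>S \<circ> S\<close> equals its own square.
\<close>

lemma central_impossible:
  assumes central: "\<And>x. x \<in> S \<Longrightarrow> bracket x z = 0"
  shows False
proof -
  have \<omega>_z: "\<omega> x z = 0" "\<omega> z x = 0" if "x \<in> S" for x
    using central[OF that] bracket_skew[of z x] by (auto simp: \<omega>_def f.zero)
  obtain a b where ab: "a \<in> S" "b \<in> S" "\<omega> a b \<noteq> 0"
  proof -
    have "\<not> (\<forall>a\<in>S. \<forall>b\<in>S. \<omega> a b = 0)"
    proof
      assume "\<forall>a\<in>S. \<forall>b\<in>S. \<omega> a b = 0"
      then have "lie.prod_span S S \<subseteq> {0}"
        by (intro lie.prod_span_least) (auto simp: bracket_eq)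
      then show False using bracket_range z span_base[of z "{z}"] by auto
    qed
    with that show thesis by blast
  qed
  have a: "a \<notin> span {z}"
    using ab \<omega>_z by (auto simp: span_singleton \<omega>_def lie.mul_scale_left f.scale)
  have b: "b \<notin> span {a, z}"
  proof
    assume "b \<in> span {a, z}"
    then obtain \<alpha> \<beta> where "b = scale \<alpha> a + scale \<beta> z" by (rule span_pairE)
    then have "\<omega> a b = \<alpha> * \<omega> a a + \<beta> * \<omega> a z"
      by (simp add: \<omega>_def lie.mul_add_right lie.mul_scale_right f.add f.scale lie.alternating f.zero)
    with ab \<omega>_z show False by simp
  qed
  have "dim {b, a, z} = 3" using a b z by (simp add: dim_insert)
  moreover have "span {b, a, z} \<subseteq> S" using ab z by (intro span_minimal) (auto simp: subspace_S)
  ultimately have S: "S = span {b, a, z}"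
    using dim_S subspace_dim_equal[of "span {b, a, z}" S] subspace_S by simp
  have radical: "\<exists>k. v = scale k z" if v: "v \<in> S" "\<And>x. x \<in> S \<Longrightarrow> \<omega> x v = 0" for v
  proof -
    obtain k where "v - scale k b \<in> span {a, z}" using v S span_breakdown_eq by blast
    then obtain l m where "v - scale k b = scale l a + scale m z" by (rule span_pairE)
    then have v_eq: "v = scale k b + scale l a + scale m z" by (simp add: algebra_simps)
    have "\<omega> a v = k * \<omega> a b + l * \<omega> a a + m * \<omega> a z"
      "\<omega> b v = k * \<omega> b b + l * \<omega> b a + m * \<omega> b z"
      by (simp_all add: v_eq \<omega>_def lie.mul_add_right lie.mul_scale_right f.add f.scale
          lie.alternating f.zero)
    then have "k = 0" "l = 0" using v ab \<omega>_z \<omega>_skew[of b a] by auto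
    with v_eq show ?thesis by auto
  qed
  have circ_z: "y \<circ>\<^sub>N z = 0" if y: "y \<in> S" for y
  proof -
    have "\<omega> x (y \<circ>\<^sub>N z) = 0" if "x \<in> S" for x
      using \<omega>_circ_symmetric[of x z y] \<omega>_z y z that by (simp add: S_intros)
    then obtain k where "y \<circ>\<^sub>N z = scale k z" using radical[of "y \<circ>\<^sub>N z"] y z S_intros by blast
    with f_prod[OF y z(1)] f_z show ?thesis by (simp add: f.scale)
  qed
  have z_circ: "z \<circ>\<^sub>N y = 0" if y: "y \<in> S" for y
  proof (cases "\<exists>x\<in>S. \<omega> y x \<noteq> 0")
    case True
    then obtain x where "x \<in> S" "\<omega> y x \<noteq> 0" by blast
    with circ_line_cocycle[of y x y] y circ_z[OF y] show ?thesis by simp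
  next
    case False
    then have "\<omega> x y = 0" if "x \<in> S" for x using that \<omega>_skew[of x y] by simp
    with radical[OF y] obtain k where "y = scale k z" by blast
    with circ_z[OF z(1)] show ?thesis by (simp add: nov.mul_scale_right)
  qed
  let ?P = "nov.prod_span S S"
  have decomp: "\<exists>u k. u \<in> ?P \<and> x = u + scale k z" if "x \<in> S" for x
  proof -
    obtain u v where "u \<in> ?P" "v \<in> span {z}" "x = u + v"
      using perfect bracket_range \<open>x \<in> S\<close> by blast
    then show ?thesis by (auto simp: span_singleton)
  qed
  have P_S: "?P \<subseteq> S" by (intro nov.prod_span_least subspace_S circ_closed)
  have "?P \<subseteq> nov.prod_span ?P ?P"
  proof (rule nov.prod_span_least[OF nov.subspace_prod_span])
    fix x y assume "x \<in> S" "y \<in> S"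
    then obtain u v k l where uv: "u \<in> ?P" "v \<in> ?P" "x = u + scale k z" "y = v + scale l z"
      using decomp by meson
    then have "x \<circ>\<^sub>N y = u \<circ>\<^sub>N v"
      using subsetD[OF P_S] z circ_z z_circ
      by (simp add: nov.mul_add_left nov.mul_add_right nov.mul_scale_left nov.mul_scale_right)
    with uv show "x \<circ>\<^sub>N y \<in> nov.prod_span ?P ?P" by (auto intro: nov.mul_in_prod_span)
  qed
  then have "?P \<subseteq> {0}" by (rule nov.solvable_perfect_trivial[OF circ_solvable])
  with decomp[OF ab(1)] obtain k where "a = scale k z" by (metis add_0 singletonD subsetD)
  with a show False by (auto simp: span_singleton)
qed

end

context perfect_gd_subalgebra
begin

text \<open>
  The value \<open>z = 0\<close> is included and covers an abelian bracket; it falls under \<open>z \<in> S \<circ> S\<close>, where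
  \<open>S = S \<circ> S\<close>.
\<close>

lemma line_case:
  assumes h: "lie.prod_span S S = span {z}"
  shows "S = {0}"
proof (cases "z \<in> nov.prod_span S S")
  case True
  then have "S \<subseteq> nov.prod_span S S"
    using perfect unfolding h
    by (auto simp: span_singleton subspace_add[OF nov.subspace_prod_span]
        subspace_scale[OF nov.subspace_prod_span] dest!: subsetD)
  then have "S \<subseteq> {0}" by (rule nov.solvable_perfect_trivial[OF circ_solvable])
  then show ?thesis using subspace_0[OF subspace_S] by auto
next
  case False
  obtain f where f: "Vector_Spaces.linear scale (*) f"
    "\<And>w. w \<in> nov.prod_span S S \<Longrightarrow> f w = 0" "f z = 1"
    using separating_functional[OF nov.subspace_prod_span False] by blast
  have "lie.prod_span S S \<subseteq> S" by (intro lie.prod_span_least subspace_S bracket_closed)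
  then have "z \<in> S" using h span_base[of z "{z}"] by auto
  moreover have "z \<noteq> 0" using False subspace_0[OF nov.subspace_prod_span] by metis
  ultimately have line: "perfect_gd_line scale circ bracket Basis S z f"
    using f h
    by (intro perfect_gd_line.intro perfect_gd_subalgebra_axioms perfect_gd_line_axioms.intro)
  have "bracket x z = 0" if "x \<in> S" for x
    using perfect_gd_line.noncentral_impossible[OF line that] by blast
  then have False by (rule perfect_gd_line.central_impossible[OF line])
  then show ?thesis ..
qed

section \<open>Bracket with two-dimensional range\<close>

text \<open>
  Suppose \<open>c = [a, b] \<noteq> 0\<close> and complete \<open>c\<close> to a basis \<open>c, d\<close> of the plane \<open>h\<close>.  Then \<open>[d, c] = l c\<close> with
  \<open>l \<noteq> 0\<close>, and since \<open>ad e\<close> acts on \<open>h\<close> as a derivation, comparing coefficients in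
  \<open>[e, [d, c]] = [[e, d], c] + [d, [e, c]]\<close> puts \<open>[e, c]\<close> and \<open>[e, d]\<close> on the line \<open>k c\<close>.  All brackets of
  \<open>S\<close> would then lie on \<open>k c\<close>.
\<close>

lemma derived_plane_abelian:
  assumes h: "lie.prod_span S S = h" "dim h = 2"
    and e: "e \<in> S" "S = span (insert e h)"
    and ab: "a \<in> h" "b \<in> h"
  shows "bracket a b = 0"
proof (rule ccontr)
  assume nz: "bracket a b \<noteq> 0"
  define c where "c = bracket a b"
  have sub: "subspace h" using h lie.subspace_prod_span by auto
  have h_S: "h \<subseteq> S" using h lie.prod_span_least[OF subspace_S bracket_closed] by blast
  have in_h: "bracket x y \<in> h" if "x \<in> S" "y \<in> S" for x y
    using that h lie.mul_in_prod_span by blast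
  have c: "c \<in> h" "c \<noteq> 0" using ab h_S in_h nz by (auto simp: c_def)
  obtain d where d: "d \<in> h" "d \<notin> span {c}" and h_eq: "h = span {c, d}"
    using plane_spanned_through[OF sub h(2) c] .
  have "bracket x y \<in> span {bracket d c}" if "x \<in> {c, d}" "y \<in> {c, d}" for x y
    using that bracket_skew[of c d] span_base[of "bracket d c" "{bracket d c}"]
    by (auto simp: lie.alternating span_zero span_neg)
  then have "bracket a b \<in> span {bracket d c}"
    using ab unfolding h_eq by (rule lie.mul_span_in[OF subspace_span])
  then have "c \<in> span {bracket d c}" by (simp only: c_def)
  then obtain \<mu> where \<mu>: "c = scale \<mu> (bracket d c)" by (auto simp: span_singleton)
  define l where "l = 1 / \<mu>"
  have "\<mu> \<noteq> 0" using \<mu> c by auto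
  then have l: "l \<noteq> 0" and dc: "bracket d c = scale l c"
    using arg_cong[OF \<mu>, of "scale l"] by (simp_all add: l_def)
  obtain \<gamma> \<delta> where ec: "bracket e c = scale \<gamma> c + scale \<delta> d"
    using in_h[of e c] e c h_S h_eq by (metis span_pairE subsetD)
  obtain \<alpha> \<beta> where ed: "bracket e d = scale \<alpha> c + scale \<beta> d"
    using in_h[of e d] e d h_S h_eq by (metis span_pairE subsetD)
  have "bracket e (bracket d c) = bracket (bracket e d) c + bracket d (bracket e c)"
  proof -
    have "bracket d (bracket c e) = - bracket d (bracket e c)"
      using bracket_skew[of c e] lie.mul_scale_right[of d "-1" "bracket e c"] by simp
    moreover have "bracket c (bracket e d) = - bracket (bracket e d) c" by (rule bracket_skew)
    ultimately show ?thesis using lie.jacobi[of e d c] by (simp add: algebra_simps)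
  qed
  then have eq: "scale (l * \<delta>) d = scale (\<beta> * l) c"
    by (simp add: dc ec ed lie.mul_add_left lie.mul_add_right lie.mul_scale_left
        lie.mul_scale_right lie.alternating scale_right_distrib mult.commute)
  have "\<delta> = 0"
  proof (rule ccontr)
    assume "\<delta> \<noteq> 0"
    then have "d = scale (1 / (l * \<delta>)) (scale (l * \<delta>) d)" using l by simp
    also have "\<dots> \<in> span {c}" unfolding eq by (intro span_scale span_base) simp
    finally show False using d by simp
  qed
  with eq c l have "\<beta> = 0" by simp
  have e_line: "bracket e c \<in> span {c}" "bracket e d \<in> span {c}" "bracket d c \<in> span {c}"
    by (simp_all add: ec ed dc \<open>\<delta> = 0\<close> \<open>\<beta> = 0\<close> span_scale span_base)
  have "bracket x y \<in> span {c}" if "x \<in> {e, c, d}" "y \<in> {e, c, d}" for x y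
    using that e_line bracket_skew[of c e] bracket_skew[of d e] bracket_skew[of c d]
    by (auto simp: lie.alternating span_zero span_neg)
  moreover have "S = span {e, c, d}"
    using e(2) h_eq by (simp add: span_insert_span)
  ultimately have "h \<subseteq> span {c}"
    unfolding h(1)[symmetric]
    by (intro lie.prod_span_least) (auto intro: lie.mul_span_in[where U="{e, c, d}" and V="{e, c, d}"])
  then show False using d by blast
qed

text \<open>
  Let \<open>D = ad e\<close> on the abelian plane \<open>h\<close>; it is injective because \<open>h = [S, S]\<close> is spanned by its values.
  For \<open>a, b, y \<in> h\<close> compatibility reads \<open>E (y \<circ> a) D b = E (y \<circ> b) D a\<close>, and choosing \<open>a\<close>
  independent of \<open>b\<close> gives \<open>E (h \<circ> h) = 0\<close>.  Compatibility also gives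
  \<open>E (e \<circ> a) = - E (a \<circ> e)\<close> on \<open>h\<close>.  Put \<open>p a = E (a \<circ> e)\<close>.  Applying \<open>E\<close> to right commutativity
  \<open>(x \<circ> y) \<circ> e = (x \<circ> e) \<circ> y\<close> gives \<open>p (x \<circ> y) = - p x p y\<close>, so \<open>p = 0\<close> on \<open>h\<close> by Novikov
  solvability, and what remains is \<open>E (x \<circ> y) = E (e \<circ> e) E x E y\<close>.
\<close>

lemma plane_case:
  assumes h: "lie.prod_span S S = h" "dim h = 2" and S_h: "S \<noteq> h"
  shows False
proof -
  have sub: "subspace h" using h lie.subspace_prod_span by auto
  have span_h: "span h = h" using sub by (simp add: span_eq_iff)
  have h_S: "h \<subseteq> S" using h lie.prod_span_least[OF subspace_S bracket_closed] by blast
  have in_h: "bracket x y \<in> h" if "x \<in> S" "y \<in> S" for x y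
    using that h lie.mul_in_prod_span by blast
  obtain e where e: "e \<in> S" "e \<notin> h" using S_h h_S by blast
  have "dim (insert e h) = 3" using h e by (simp add: dim_insert span_h)
  moreover have "span (insert e h) \<subseteq> S"
    using e h_S by (intro span_minimal) (auto simp: subspace_S)
  ultimately have S: "S = span (insert e h)"
    using dim_S subspace_dim_equal[of "span (insert e h)" S] subspace_S by simp
  have abel: "bracket a b = 0" if "a \<in> h" "b \<in> h" for a b
    using derived_plane_abelian[OF h e(1) S that] .
  obtain E where E: "Vector_Spaces.linear scale (*) E" "\<And>w. w \<in> h \<Longrightarrow> E w = 0" "E e = 1"
    using separating_functional[OF sub e(2)] by blast
  interpret E: Vector_Spaces.linear scale "(*)" E by (rule E)
  have split: "x - scale (E x) e \<in> h" if x: "x \<in> S" for x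
  proof -
    obtain k where k: "x - scale k e \<in> h"
      using span_breakdown_eq[of x e h] x[unfolded S] unfolding span_h by blast
    then have "E (x - scale k e) = 0" by (rule E)
    with E(3) have "E x = k" by (simp add: E.diff E.scale)
    with k show ?thesis by simp
  qed
  have E0: "x \<in> h" if "x \<in> S" "E x = 0" for x using split[OF that(1)] that by simp
  have ad: "bracket a x = - scale (E x) (bracket e a)" if "a \<in> h" "x \<in> S" for a x
  proof -
    have "bracket a (x - scale (E x) e) = 0" using abel that split by blast
    then show ?thesis using bracket_skew[of e a]
      by (simp add: lie.mul_diff_right lie.mul_scale_right)
  qed
  \<comment> \<open>If \<open>a \<noteq> 0\<close> and \<open>a, d\<close> is a basis of \<open>h\<close>, then up to sign only \<open>[e, d]\<close> survives among brackets
    of basis vectors of \<open>S\<close>, and \<open>h\<close> is too small.\<close>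
  have inj: "a = 0" if a: "a \<in> h" "bracket e a = 0" for a
  proof (rule ccontr)
    assume "a \<noteq> 0"
    then obtain d where d: "d \<in> h" "d \<notin> span {a}" and h_eq: "h = span {a, d}"
      using plane_spanned_through[OF sub h(2) a(1)] by blast
    have "bracket x y \<in> span {bracket e d}" if "x \<in> {e, a, d}" "y \<in> {e, a, d}" for x y
      using that a d abel[of a d] abel[of d a] bracket_skew[of a e] bracket_skew[of d e]
      by (auto simp: lie.alternating span_zero span_neg span_base)
    moreover have "S = span {e, a, d}" using S h_eq by (simp add: span_insert_span)
    ultimately have "h \<subseteq> span {bracket e d}"
      unfolding h(1)[symmetric]
      by (intro lie.prod_span_least) (auto intro: lie.mul_span_in[where U="{e, a, d}" and V="{e, a, d}"])
    then have "dim h \<le> card {bracket e d}" by (rule dim_le_card) simp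
    with h show False by simp
  qed
  have hh: "E (y \<circ>\<^sub>N b) = 0" if y: "y \<in> h" and b: "b \<in> h" for y b
  proof (cases "b = 0")
    case True then show ?thesis by (simp add: nov.mul_zero_right E.zero)
  next
    case False
    obtain a where a: "a \<in> h" "a \<notin> span {b}"
      using plane_spanned_through[OF sub h(2) b False] by blast
    have "scale (E (y \<circ>\<^sub>N a)) (bracket e b) - scale (E (y \<circ>\<^sub>N b)) (bracket e a) = 0"
      using compatible[of a y b] ad[of a "y \<circ>\<^sub>N b"] ad[of b "y \<circ>\<^sub>N a"] abel y a b h_S circ_closed
      by (simp add: subset_eq nov.mul_zero_left nov.mul_zero_right)
    then have "bracket e (scale (E (y \<circ>\<^sub>N a)) b - scale (E (y \<circ>\<^sub>N b)) a) = 0"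
      by (simp add: lie.mul_diff_right lie.mul_scale_right)
    then have eq: "scale (E (y \<circ>\<^sub>N b)) a = scale (E (y \<circ>\<^sub>N a)) b"
      using inj a b sub by (metis eq_iff_diff_eq_0 subspace_diff subspace_scale)
    show ?thesis
    proof (rule ccontr)
      assume nz: "E (y \<circ>\<^sub>N b) \<noteq> 0"
      then have "a = scale (1 / E (y \<circ>\<^sub>N b)) (scale (E (y \<circ>\<^sub>N b)) a)" by simp
      also have "\<dots> \<in> span {b}" unfolding eq by (intro span_scale span_base) simp
      finally show False using a by simp
    qed
  qed
  have anti: "E (e \<circ>\<^sub>N a) = - E (a \<circ>\<^sub>N e)" if "a \<in> h" for a
  proof -
    \<comment> \<open>The claim is linear in \<open>a\<close> and \<open>h\<close> is spanned by brackets, so it suffices to test \<open>a = [e, x]\<close>,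
      where it is the image under \<open>E\<close> of compatibility for \<open>x, e, e\<close>.\<close>
    let ?W = "{x. E (x \<circ>\<^sub>N e) + E (e \<circ>\<^sub>N x) = 0}"
    have W: "subspace ?W"
    proof -
      have "E ((x + y) \<circ>\<^sub>N e) + E (e \<circ>\<^sub>N (x + y))
          = (E (x \<circ>\<^sub>N e) + E (e \<circ>\<^sub>N x)) + (E (y \<circ>\<^sub>N e) + E (e \<circ>\<^sub>N y))" for x y
        by (simp add: nov.mul_add_left nov.mul_add_right E.add)
      moreover have "E (scale k x \<circ>\<^sub>N e) + E (e \<circ>\<^sub>N scale k x)
          = k * (E (x \<circ>\<^sub>N e) + E (e \<circ>\<^sub>N x))" for k x
        by (simp add: nov.mul_scale_left nov.mul_scale_right E.scale distrib_left)
      ultimately show ?thesis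
        by (simp add: subspace_def nov.mul_zero_left nov.mul_zero_right E.zero)
    qed
    have W_e: "bracket e x \<in> ?W" if x: "x \<in> S" for x
    proof -
      have "E (bracket x (e \<circ>\<^sub>N e)) = 0" "E (bracket e (e \<circ>\<^sub>N x)) = 0"
        using x e in_h E(2) circ_closed by auto
      moreover have "e \<circ>\<^sub>N bracket x e = - (e \<circ>\<^sub>N bracket e x)"
        using bracket_skew[of x e] nov.mul_scale_right[of e "-1" "bracket e x"] by simp
      ultimately show ?thesis
        using arg_cong[OF compatible[of x e e], of E]
        by (simp add: lie.alternating nov.mul_zero_left E.add E.diff E.neg E.zero)
    qed
    have "bracket x y \<in> ?W" if x: "x \<in> S" and y: "y \<in> S" for x y
    proof -
      let ?x = "x - scale (E x) e"
      have "bracket x y = bracket ?x y + scale (E x) (bracket e y)"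
        by (simp add: lie.mul_diff_left lie.mul_scale_left)
      also have "bracket ?x y = scale (- E y) (bracket e ?x)"
        using ad[OF split[OF x] y] by simp
      finally have "bracket x y = scale (- E y) (bracket e ?x) + scale (E x) (bracket e y)" .
      moreover have "bracket e ?x \<in> ?W" using subsetD[OF h_S split[OF x]] by (rule W_e)
      ultimately show ?thesis
        using subspace_add[OF W subspace_scale[OF W] subspace_scale[OF W W_e[OF y]]]
        by (simp only:)
    qed
    then have "h \<subseteq> ?W" unfolding h(1)[symmetric] by (intro lie.prod_span_least W)
    with that show ?thesis by (auto simp: eq_neg_iff_add_eq_0 add.commute)
  qed
  have h_closed: "x \<circ>\<^sub>N y \<in> h" if "x \<in> h" "y \<in> h" for x y
    using E0[OF circ_closed[OF that[THEN subsetD[OF h_S]]] hh[OF that]] .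
  have mult: "E ((x \<circ>\<^sub>N y) \<circ>\<^sub>N e) = - 1 * E (x \<circ>\<^sub>N e) * E (y \<circ>\<^sub>N e)"
    if x: "x \<in> h" and y: "y \<in> h" for x y
  proof -
    have xe: "x \<circ>\<^sub>N e \<in> S" using x e h_S circ_closed by blast
    let ?r = "x \<circ>\<^sub>N e - scale (E (x \<circ>\<^sub>N e)) e"
    have "E ((x \<circ>\<^sub>N y) \<circ>\<^sub>N e) = E ((x \<circ>\<^sub>N e) \<circ>\<^sub>N y)" by (simp only: nov.right_commutative[of x y e])
    also have "(x \<circ>\<^sub>N e) \<circ>\<^sub>N y = ?r \<circ>\<^sub>N y + scale (E (x \<circ>\<^sub>N e)) (e \<circ>\<^sub>N y)"
      by (simp add: nov.mul_diff_left nov.mul_scale_left)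
    also have "E \<dots> = - (E (x \<circ>\<^sub>N e) * E (y \<circ>\<^sub>N e))"
      using hh[OF split[OF xe] y] anti[OF y] by (simp add: E.add E.scale)
    finally show ?thesis by simp
  qed
  have he: "E (x \<circ>\<^sub>N e) = 0" if "x \<in> h" for x
    by (rule nov.solvable_no_character[where \<phi> = "\<lambda>x. E (x \<circ>\<^sub>N e)" and T = h,
          OF circ_solvable _ h_closed mult _ that])
      (simp_all add: nov.mul_zero_left E.zero)
  have expand: "E ((p + scale k e) \<circ>\<^sub>N (q + scale l e)) = E (e \<circ>\<^sub>N e) * k * l"
    if p: "p \<in> h" and q: "q \<in> h" for p q k l
    by (simp add: nov.mul_add_left nov.mul_add_right nov.mul_scale_left nov.mul_scale_right
        E.add E.scale hh[OF p q] he[OF p] he[OF q] anti[OF q])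
  have "E (x \<circ>\<^sub>N y) = E (e \<circ>\<^sub>N e) * E x * E y" if x: "x \<in> S" and y: "y \<in> S" for x y
    using expand[OF split[OF x] split[OF y], of "E x" "E y"] by simp
  then have "E e = 0"
    by (rule character_vanishes[OF E(1) _ E(2)[OF in_h] e(1)])
  with E show False by simp
qed

lemma perfect_eq_zero: "S = {0}"
proof (rule ccontr)
  assume nz: "S \<noteq> {0}"
  let ?h = "lie.prod_span S S"
  have h_S: "?h \<subseteq> S" by (intro lie.prod_span_least subspace_S bracket_closed)
  have ne: "S \<noteq> ?h"
    using lie.solvable_perfect_trivial[OF bracket_solvable, of S] nz subspace_0[OF subspace_S]
    by auto
  then have "\<not> 3 \<le> dim ?h"
    using subspace_dim_equal[OF lie.subspace_prod_span subspace_S h_S] dim_S by force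
  moreover have "dim ?h \<noteq> 2" using plane_case[OF refl _ ne] by blast
  ultimately have small: "dim ?h \<le> 1" by linarith
  obtain B where B: "B \<subseteq> ?h" "independent B" "?h \<subseteq> span B" "card B = dim ?h"
    using basis_exists[of ?h] by blast
  then have h_B: "?h = span B" using span_subspace[of B ?h] lie.subspace_prod_span by simp
  have "finite B" using B(2) by (rule finiteI_independent)
  then have "\<exists>z. ?h = span {z}"
  proof (cases "B = {}")
    case True
    then have "?h = span {0}" using h_B span_insert_0[of "{}"] by (simp only:)
    then show ?thesis ..
  next
    case False
    then have "card B = 1" using B(4) small \<open>finite B\<close> card_gt_0_iff[of B] by linarith
    then show ?thesis using h_B by (auto simp: card_1_singleton_iff)
  qed
  then show False using line_case nz by blast
qed

end

section \<open>Descent along the derived series\<close>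

text \<open>
  A member of the derived series that equals its successor is perfect, hence zero; so the dimension
  drops at every step until it is zero, and \<open>A\<^sup>(\<^sup>3\<^sup>) = 0\<close>.
\<close>

theorem proposition4p1:
  fixes scale :: "'k::{alg_closed_field, field_char_0} \<Rightarrow> 'a::ab_group_add \<Rightarrow> 'a"
    and circ bracket :: "'a \<Rightarrow> 'a \<Rightarrow> 'a"
    and Basis :: "'a set"
  assumes "gd_algebra scale circ bracket"
    and "finite_dimensional_vector_space scale Basis"
    and "vector_space.dim scale (UNIV :: 'a set) \<le> 3"
    and "nonassoc_algebra.solvable scale bracket"
    and "nonassoc_algebra.solvable scale circ"
  shows "gd_algebra.gd_solvable scale circ bracket"
proof -
  interpret gd_algebra scale circ bracket by fact
  interpret finite_dimensional_vector_space scale Basis by fact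
  let ?G = "gd_derived_series"
  have sub: "subspace (?G n)" for n
    by (cases n) (auto intro!: subspace_sums nov.subspace_prod_span lie.subspace_prod_span)
  have circ_next: "circ x y \<in> ?G (Suc n)" if "x \<in> ?G n" "y \<in> ?G n" for x y n
    unfolding gd_derived_series.simps
    by (rule CollectI, rule exI[of _ "circ x y"], rule exI[of _ 0])
      (simp add: that nov.mul_in_prod_span subspace_0[OF lie.subspace_prod_span])
  have bracket_next: "bracket x y \<in> ?G (Suc n)" if "x \<in> ?G n" "y \<in> ?G n" for x y n
    unfolding gd_derived_series.simps
    by (rule CollectI, rule exI[of _ 0], rule exI[of _ "bracket x y"])
      (simp add: that lie.mul_in_prod_span subspace_0[OF nov.subspace_prod_span])
  have decr: "?G (Suc n) \<subseteq> ?G n" for n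
  proof (induction n)
    case 0 show ?case by simp
  next
    case (Suc n)
    have "nov.prod_span (?G (Suc n)) (?G (Suc n)) \<subseteq> nov.prod_span (?G n) (?G n)"
      "lie.prod_span (?G (Suc n)) (?G (Suc n)) \<subseteq> lie.prod_span (?G n) (?G n)"
      by (intro nov.prod_span_mono lie.prod_span_mono Suc)+
    then show ?case by (subst (1 2) gd_derived_series.simps(2)) blast
  qed
  have bound: "dim (?G n) \<le> 3 - n" for n
  proof (induction n)
    case 0 show ?case using assms(3) by simp
  next
    case (Suc n)
    show ?case
    proof (cases "?G (Suc n) = ?G n")
      case True
      interpret perfect_gd_subalgebra scale circ bracket Basis "?G n"
        using sub Suc assms circ_next[of _ n] bracket_next[of _ n] decr[of n] True
        by unfold_locales auto
      from perfect_eq_zero True have "?G (Suc n) = {0}" by simp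
      then show ?thesis by (simp del: gd_derived_series.simps)
    next
      case False
      then have "dim (?G (Suc n)) < dim (?G n)"
        using subspace_dim_equal[OF sub sub decr[of n]] by (metis not_le)
      with Suc show ?thesis by linarith
    qed
  qed
  have "dim (?G 3) = 0" using bound[of 3] by simp
  then have "?G 3 = {0}" using sub[of 3] subspace_0[OF sub[of 3]] dim_eq_0 by blast
  then show ?thesis unfolding gd_solvable_def by blast
qed

end
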